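(* Let $(R,\mathfrak m)$ be a Noetherian local domain and let $\{(\mathfrak a_\bullet(t),\mathfrak b_\bullet(t))\}_{t\in[0,1]}$ be a one-parameter family of pairs of filtrations of $\mathfrak m$-primary ideals in $R$. Let $\mathcal V=\{v_1,\dots,v_N\}$ be a fixed finite set of divisorial valuations centered at $\mathfrak m$, and put $\alpha_i(t):=v_i(\mathfrak a_\bullet(t))$, $\beta_i(t):=v_i(\mathfrak b_\bullet(t))$, and $L(t):=\mathcal L_{\mathfrak b_\bullet(t)}(\mathfrak a_\bullet(t))$. Assume that (1) for all $t\in[0,1]$ one has $L(t)=\max_{1\le i\le N}\frac{\alpha_i(t)}{\beta_i(t)}$; (2) the path $t\mapsto(\mathfrak a_\bullet(t),\mathfrak b_\bullet(t))$ is valuation-concave, and $\beta_i(t)>0$ for all $i$ and all $t\in[0,1]$. If the function $t\mapsto1/L(t)$ is affine on $[0,1]$, then there exists an index $j\in\{1,\dots,N\}$ such that $$L(t)=\frac{\alpha_j(t)}{\beta_j(t)}\quad\text{for all }t\in[0,1].$$ Equivalently, for every $t\in[0,1]$ the index $j$ belongs to the maximizer set $\{i:\ \alpha_i(t)/\beta_i(t)=\max_k\alpha_k(t)/\beta_k(t)\}$.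
   Context: A filtration is a family $\{\mathfrak a_p\}_{p\ge1}$ of proper ideals with $\mathfrak a_p\mathfrak a_{p'}\subseteq\mathfrak a_{p+p'}$ and $\mathfrak a_{p+1}\subseteq\mathfrak a_p$ for all $p,p'\ge1$. Algebraic Łojasiewicz exponent: $\mathcal L_{\mathfrak b_\bullet}(\mathfrak a_\bullet):=\inf\{\frac qp\in\mathbb Q_{>0}:\ \mathfrak b_{qt}\subseteq\overline{\mathfrak a_{pt}}\text{ for all integers }t\gg1\}\in\mathbb R_{\ge0}\cup\{\infty\}$, with $\inf\emptyset=\infty$, where $\overline I$ is the integral closure of $I$. For a valuation $v$ centered at $\mathfrak m$ (nonnegative on $R$, positive on $\mathfrak m$), $v(I):=\min\{v(x):x\in I\}$ and $v(\mathfrak a_\bullet):=\lim_{p\to\infty}\frac{v(\mathfrak a_p)}p=\inf_{p\ge1}\frac{v(\mathfrak a_p)}p$. Valuation-concave (also called valuation-affine): for every divisorial valuation $v$ centered at $\mathfrak m$, the functions $t\mapsto v(\mathfrak a_\bullet(t))$ and $t\mapsto v(\mathfrak b_\bullet(t))$ are affine on $[0,1]$. *)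

theory Defs
  imports "HOL-Algebra.Algebra" "HOL-Library.Extended_Real" "HOL-Library.Extended_Nat"
begin

section \<open>The field of fractions of a domain\<close>

definition frac_rel :: "('a, 'r) ring_scheme \<Rightarrow> (('a \<times> 'a) \<times> ('a \<times> 'a)) set" where
  "frac_rel R = {((a, b), (c, d)). a \<in> carrier R \<and> b \<in> carrier R - {\<zero>\<^bsub>R\<^esub>} \<and>
     c \<in> carrier R \<and> d \<in> carrier R - {\<zero>\<^bsub>R\<^esub>} \<and> a \<otimes>\<^bsub>R\<^esub> d = c \<otimes>\<^bsub>R\<^esub> b}"

definition fraction :: "('a, 'r) ring_scheme \<Rightarrow> 'a \<Rightarrow> 'a \<Rightarrow> ('a \<times> 'a) set" where
  "fraction R a b = frac_rel R `` {(a, b)}"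

text \<open>The unions below range over all representatives; they all contribute the same class
  (lemmas \<open>frac_mult\<close> and \<open>frac_add\<close>).\<close>

definition frac_field :: "('a, 'r) ring_scheme \<Rightarrow> ('a \<times> 'a) set ring" where
  "frac_field R = \<lparr>
     carrier = (carrier R \<times> (carrier R - {\<zero>\<^bsub>R\<^esub>})) // frac_rel R,
     Group.monoid.mult = (\<lambda>A B. \<Union>((\<lambda>((a, b), (c, d)).
               fraction R (a \<otimes>\<^bsub>R\<^esub> c) (b \<otimes>\<^bsub>R\<^esub> d)) ` (A \<times> B))),
     Group.monoid.one = fraction R \<one>\<^bsub>R\<^esub> \<one>\<^bsub>R\<^esub>,
     Ring.ring.zero = fraction R \<zero>\<^bsub>R\<^esub> \<one>\<^bsub>R\<^esub>,
     Ring.ring.add = (\<lambda>A B. \<Union>((\<lambda>((a, b), (c, d)).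
               fraction R (a \<otimes>\<^bsub>R\<^esub> d \<oplus>\<^bsub>R\<^esub> c \<otimes>\<^bsub>R\<^esub> b) (b \<otimes>\<^bsub>R\<^esub> d)) ` (A \<times> B)))\<rparr>"

lemma Union_image_const: "s \<in> S \<Longrightarrow> (\<And>x. x \<in> S \<Longrightarrow> f x = z) \<Longrightarrow> \<Union>(f ` S) = z"
  by auto

context domain
begin

lemma frac_cross:
  assumes "a \<otimes> d = c \<otimes> b" "c \<otimes> f = e \<otimes> d"
    and "a \<in> carrier R" "b \<in> carrier R" "c \<in> carrier R" "d \<in> carrier R - {\<zero>}"
    and "e \<in> carrier R" "f \<in> carrier R"
  shows "a \<otimes> f = e \<otimes> b"
proof -
  have d: "d \<in> carrier R" "d \<noteq> \<zero>" using assms by auto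
  have "d \<otimes> (a \<otimes> f) = (a \<otimes> d) \<otimes> f" using assms(3-) d by (simp add: m_ac)
  also have "\<dots> = (c \<otimes> f) \<otimes> b" unfolding assms(1) using assms(3-) d by (simp add: m_ac)
  also have "\<dots> = d \<otimes> (e \<otimes> b)" unfolding assms(2) using assms(3-) d by (simp add: m_ac)
  finally show ?thesis using assms d m_lcancel[of d] by simp
qed

lemma equiv_frac_rel: "equiv (carrier R \<times> (carrier R - {\<zero>})) (frac_rel R)"
proof (rule equivI)
  show "frac_rel R \<subseteq> (carrier R \<times> (carrier R - {\<zero>})) \<times> (carrier R \<times> (carrier R - {\<zero>}))"
    by (auto simp: frac_rel_def)
  show "refl_on (carrier R \<times> (carrier R - {\<zero>})) (frac_rel R)"
    by (auto simp: refl_on_def frac_rel_def)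
  show "sym (frac_rel R)" by (auto simp: sym_def frac_rel_def)
  show "trans (frac_rel R)"
    by (rule transI) (auto simp: frac_rel_def intro: frac_cross)
qed

lemma frac_eq_iff:
  assumes "a \<in> carrier R" "b \<in> carrier R - {\<zero>}" "c \<in> carrier R" "d \<in> carrier R - {\<zero>}"
  shows "fraction R a b = fraction R c d \<longleftrightarrow> a \<otimes> d = c \<otimes> b"
  unfolding fraction_def using assms
  by (subst eq_equiv_class_iff[OF equiv_frac_rel]) (auto simp: frac_rel_def)

lemma carrier_frac_field:
  "carrier (frac_field R) = {fraction R a b | a b. a \<in> carrier R \<and> b \<in> carrier R - {\<zero>}}"
  by (auto simp: frac_field_def fraction_def quotient_def)

lemma fraction_closed:
  "a \<in> carrier R \<Longrightarrow> b \<in> carrier R \<Longrightarrow> b \<noteq> \<zero> \<Longrightarrow> fraction R a b \<in> carrier (frac_field R)"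
  by (auto simp: carrier_frac_field)

lemma frac_mem: "(c, d) \<in> fraction R a b \<longleftrightarrow> ((a, b), (c, d)) \<in> frac_rel R"
  by (simp add: fraction_def Image_singleton_iff)

lemma frac_self: "a \<in> carrier R \<Longrightarrow> b \<in> carrier R - {\<zero>} \<Longrightarrow> (a, b) \<in> fraction R a b"
  by (auto simp: frac_mem frac_rel_def)

lemma frac_mult:
  assumes "a \<in> carrier R" "b \<in> carrier R - {\<zero>}" "c \<in> carrier R" "d \<in> carrier R - {\<zero>}"
  shows "fraction R a b \<otimes>\<^bsub>frac_field R\<^esub> fraction R c d = fraction R (a \<otimes> c) (b \<otimes> d)"
proof -
  have *: "fraction R (a' \<otimes> c') (b' \<otimes> d') = fraction R (a \<otimes> c) (b \<otimes> d)"
    if "(a', b') \<in> fraction R a b" "(c', d') \<in> fraction R c d" for a' b' c' d'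
  proof -
    have m: "a' \<in> carrier R" "b' \<in> carrier R" "b' \<noteq> \<zero>" "c' \<in> carrier R" "d' \<in> carrier R" "d' \<noteq> \<zero>"
      "a \<otimes> b' = a' \<otimes> b" "c \<otimes> d' = c' \<otimes> d"
      using that by (auto simp: frac_mem frac_rel_def)
    have "(a \<otimes> c) \<otimes> (b' \<otimes> d') = (a \<otimes> b') \<otimes> (c \<otimes> d')" using m(1-6) assms by (simp add: m_ac)
    also have "\<dots> = (a' \<otimes> c') \<otimes> (b \<otimes> d)" using m(1-6) assms unfolding m(7,8) by (simp add: m_ac)
    finally show ?thesis using m assms by (subst frac_eq_iff) (auto simp: integral_iff)
  qed
  show ?thesis
    unfolding frac_field_def monoid.simps ring.simps
    by (rule Union_image_const[of "((a, b), (c, d))"])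
      (use frac_self[OF assms(1,2)] frac_self[OF assms(3,4)] in simp, clarify, rule *)
qed

lemma frac_add:
  assumes "a \<in> carrier R" "b \<in> carrier R - {\<zero>}" "c \<in> carrier R" "d \<in> carrier R - {\<zero>}"
  shows "fraction R a b \<oplus>\<^bsub>frac_field R\<^esub> fraction R c d = fraction R (a \<otimes> d \<oplus> c \<otimes> b) (b \<otimes> d)"
proof -
  have *: "fraction R (a' \<otimes> d' \<oplus> c' \<otimes> b') (b' \<otimes> d') = fraction R (a \<otimes> d \<oplus> c \<otimes> b) (b \<otimes> d)"
    if "(a', b') \<in> fraction R a b" "(c', d') \<in> fraction R c d" for a' b' c' d'
  proof -
    have m: "a' \<in> carrier R" "b' \<in> carrier R" "b' \<noteq> \<zero>" "c' \<in> carrier R" "d' \<in> carrier R" "d' \<noteq> \<zero>"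
      "a \<otimes> b' = a' \<otimes> b" "c \<otimes> d' = c' \<otimes> d"
      using that by (auto simp: frac_mem frac_rel_def)
    have "(a \<otimes> d \<oplus> c \<otimes> b) \<otimes> (b' \<otimes> d') = (a \<otimes> b') \<otimes> (d \<otimes> d') \<oplus> (c \<otimes> d') \<otimes> (b \<otimes> b')"
      using m(1-6) assms by (simp add: m_ac l_distr r_distr)
    also have "\<dots> = (a' \<otimes> d' \<oplus> c' \<otimes> b') \<otimes> (b \<otimes> d)"
      using m(1-6) assms unfolding m(7,8) by (simp add: m_ac l_distr r_distr)
    finally show ?thesis using m assms by (subst frac_eq_iff) (auto simp: integral_iff)
  qed
  show ?thesis
    unfolding frac_field_def monoid.simps ring.simps
    by (rule Union_image_const[of "((a, b), (c, d))"])
      (use frac_self[OF assms(1,2)] frac_self[OF assms(3,4)] in simp, clarify, rule *)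
qed

lemma frac_one: "\<one>\<^bsub>frac_field R\<^esub> = fraction R \<one> \<one>" and frac_zero: "\<zero>\<^bsub>frac_field R\<^esub> = fraction R \<zero> \<one>"
  by (simp_all add: frac_field_def)

lemma field_frac_field: "field (frac_field R)"
proof -
  note simps = frac_mult frac_add frac_one frac_zero frac_eq_iff integral_iff
  have one: "\<one> \<in> carrier R - {\<zero>}" by simp
  have "abelian_group (frac_field R)"
  proof (rule abelian_groupI)
    fix x y z assume xyz: "x \<in> carrier (frac_field R)" "y \<in> carrier (frac_field R)"
      "z \<in> carrier (frac_field R)"
    then obtain a b c d e f where x: "x = fraction R a b" "y = fraction R c d" "z = fraction R e f"
      and m: "a \<in> carrier R" "b \<in> carrier R" "b \<noteq> \<zero>" "c \<in> carrier R" "d \<in> carrier R" "d \<noteq> \<zero>"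
        "e \<in> carrier R" "f \<in> carrier R" "f \<noteq> \<zero>"
      by (auto simp: carrier_frac_field)
    show "(x \<oplus>\<^bsub>frac_field R\<^esub> y) \<oplus>\<^bsub>frac_field R\<^esub> z = x \<oplus>\<^bsub>frac_field R\<^esub> (y \<oplus>\<^bsub>frac_field R\<^esub> z)"
      using m by (simp add: x simps m_ac l_distr r_distr a_ac)
  next
    fix x y assume "x \<in> carrier (frac_field R)" "y \<in> carrier (frac_field R)"
    then obtain a b c d where x: "x = fraction R a b" "y = fraction R c d"
      and m: "a \<in> carrier R" "b \<in> carrier R" "b \<noteq> \<zero>" "c \<in> carrier R" "d \<in> carrier R" "d \<noteq> \<zero>"
      by (auto simp: carrier_frac_field)
    show "x \<oplus>\<^bsub>frac_field R\<^esub> y = y \<oplus>\<^bsub>frac_field R\<^esub> x"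
      using m by (simp add: x simps m_ac l_distr r_distr a_ac)
    show "x \<oplus>\<^bsub>frac_field R\<^esub> y \<in> carrier (frac_field R)"
      using m by (simp add: x simps fraction_closed)
  next
    show "\<zero>\<^bsub>frac_field R\<^esub> \<in> carrier (frac_field R)"
      using one by (simp add: frac_zero fraction_closed)
  next
    fix x assume "x \<in> carrier (frac_field R)"
    then obtain a b where x: "x = fraction R a b"
      and m: "a \<in> carrier R" "b \<in> carrier R" "b \<noteq> \<zero>"
      by (auto simp: carrier_frac_field)
    show "\<zero>\<^bsub>frac_field R\<^esub> \<oplus>\<^bsub>frac_field R\<^esub> x = x"
      using m by (simp add: x simps)
    have "fraction R (\<ominus> a) b \<oplus>\<^bsub>frac_field R\<^esub> x = \<zero>\<^bsub>frac_field R\<^esub>"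
      using m by (simp add: x simps l_minus m_comm[of b a] l_neg)
    then show "\<exists>y\<in>carrier (frac_field R). y \<oplus>\<^bsub>frac_field R\<^esub> x = \<zero>\<^bsub>frac_field R\<^esub>"
      by (rule bexI) (use m in \<open>simp add: fraction_closed\<close>)
  qed
  moreover have "comm_monoid (frac_field R)"
  proof (rule comm_monoidI)
    fix x y z assume "x \<in> carrier (frac_field R)" "y \<in> carrier (frac_field R)"
      "z \<in> carrier (frac_field R)"
    then obtain a b c d e f where x: "x = fraction R a b" "y = fraction R c d" "z = fraction R e f"
      and m: "a \<in> carrier R" "b \<in> carrier R" "b \<noteq> \<zero>" "c \<in> carrier R" "d \<in> carrier R" "d \<noteq> \<zero>"
        "e \<in> carrier R" "f \<in> carrier R" "f \<noteq> \<zero>"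
      by (auto simp: carrier_frac_field)
    show "(x \<otimes>\<^bsub>frac_field R\<^esub> y) \<otimes>\<^bsub>frac_field R\<^esub> z = x \<otimes>\<^bsub>frac_field R\<^esub> (y \<otimes>\<^bsub>frac_field R\<^esub> z)"
      using m by (simp add: x simps m_ac)
  next
    fix x y assume "x \<in> carrier (frac_field R)" "y \<in> carrier (frac_field R)"
    then obtain a b c d where x: "x = fraction R a b" "y = fraction R c d"
      and m: "a \<in> carrier R" "b \<in> carrier R" "b \<noteq> \<zero>" "c \<in> carrier R" "d \<in> carrier R" "d \<noteq> \<zero>"
      by (auto simp: carrier_frac_field)
    show "x \<otimes>\<^bsub>frac_field R\<^esub> y = y \<otimes>\<^bsub>frac_field R\<^esub> x"
      using m by (simp add: x simps m_ac)
    show "x \<otimes>\<^bsub>frac_field R\<^esub> y \<in> carrier (frac_field R)"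
      using m by (simp add: x simps fraction_closed)
  next
    show "\<one>\<^bsub>frac_field R\<^esub> \<in> carrier (frac_field R)"
      using one by (simp add: frac_one fraction_closed)
  next
    fix x assume "x \<in> carrier (frac_field R)"
    then obtain a b where x: "x = fraction R a b"
      and m: "a \<in> carrier R" "b \<in> carrier R" "b \<noteq> \<zero>"
      by (auto simp: carrier_frac_field)
    show "\<one>\<^bsub>frac_field R\<^esub> \<otimes>\<^bsub>frac_field R\<^esub> x = x"
      using m by (simp add: x simps)
  qed
  ultimately have cr: "cring (frac_field R)"
  proof (rule cringI)
    fix x y z assume "x \<in> carrier (frac_field R)" "y \<in> carrier (frac_field R)"
      "z \<in> carrier (frac_field R)"
    then obtain a b c d e f where x: "x = fraction R a b" "y = fraction R c d" "z = fraction R e f"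
      and m: "a \<in> carrier R" "b \<in> carrier R" "b \<noteq> \<zero>" "c \<in> carrier R" "d \<in> carrier R" "d \<noteq> \<zero>"
        "e \<in> carrier R" "f \<in> carrier R" "f \<noteq> \<zero>"
      by (auto simp: carrier_frac_field)
    show "(x \<oplus>\<^bsub>frac_field R\<^esub> y) \<otimes>\<^bsub>frac_field R\<^esub> z
        = x \<otimes>\<^bsub>frac_field R\<^esub> z \<oplus>\<^bsub>frac_field R\<^esub> y \<otimes>\<^bsub>frac_field R\<^esub> z"
      using m by (simp add: x simps m_ac l_distr r_distr)
  qed
  show ?thesis
  proof (rule cring.cring_fieldI2[OF cr])
    show "\<zero>\<^bsub>frac_field R\<^esub> \<noteq> \<one>\<^bsub>frac_field R\<^esub>" by (simp add: simps)
  next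
    fix x assume "x \<in> carrier (frac_field R)" "x \<noteq> \<zero>\<^bsub>frac_field R\<^esub>"
    then obtain a b where x: "x = fraction R a b" "fraction R a b \<noteq> fraction R \<zero> \<one>"
      and m': "a \<in> carrier R" "b \<in> carrier R" "b \<noteq> \<zero>"
      by (auto simp: carrier_frac_field frac_zero)
    then have m: "a \<in> carrier R" "b \<in> carrier R" "b \<noteq> \<zero>" "a \<noteq> \<zero>"
      by (auto simp: frac_eq_iff)
    have "x \<otimes>\<^bsub>frac_field R\<^esub> fraction R b a = \<one>\<^bsub>frac_field R\<^esub>"
      using m by (simp add: x(1) simps m_ac)
    then show "\<exists>y\<in>carrier (frac_field R). x \<otimes>\<^bsub>frac_field R\<^esub> y = \<one>\<^bsub>frac_field R\<^esub>"
      by (rule bexI) (use m in \<open>simp add: fraction_closed\<close>)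
  qed
qed

end

section \<open>Local rings, primary ideals, integral closure, dimension\<close>

definition local_ring :: "('a, 'r) ring_scheme \<Rightarrow> 'a set \<Rightarrow> bool" where
  "local_ring R M \<longleftrightarrow> cring R \<and> maximalideal M R \<and> (\<forall>J. maximalideal J R \<longrightarrow> J = M)"

definition radical :: "('a, 'r) ring_scheme \<Rightarrow> 'a set \<Rightarrow> 'a set" where
  "radical R I = {x \<in> carrier R. \<exists>n::nat. x [^]\<^bsub>R\<^esub> n \<in> I}"

definition primary_ideal :: "('a, 'r) ring_scheme \<Rightarrow> 'a set \<Rightarrow> bool" where
  "primary_ideal R Q \<longleftrightarrow> ideal Q R \<and> Q \<noteq> carrier R \<and>
     (\<forall>x\<in>carrier R. \<forall>y\<in>carrier R. x \<otimes>\<^bsub>R\<^esub> y \<in> Q \<longrightarrow> x \<in> Q \<or> y \<in> radical R Q)"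

definition primary_to :: "('a, 'r) ring_scheme \<Rightarrow> 'a set \<Rightarrow> 'a set \<Rightarrow> bool" where
  "primary_to R M Q \<longleftrightarrow> primary_ideal R Q \<and> radical R Q = M"

text \<open>\<open>x\<close> is integral over \<open>I\<close> if \<open>x\<^sup>n + c\<^sub>1 x\<^sup>n\<^sup>-\<^sup>1 + \<dots> + c\<^sub>n = 0\<close> for some \<open>n \<ge> 1\<close> and
  \<open>c\<^sub>i \<in> I\<^sup>i\<close>; the powers of \<open>I\<close> are taken in the semiring of ideals of \<open>R\<close>.\<close>

definition integral_closure :: "('a, 'r) ring_scheme \<Rightarrow> 'a set \<Rightarrow> 'a set" where
  "integral_closure R I = {x \<in> carrier R. \<exists>n::nat. n \<ge> 1 \<and>
     (\<exists>c. (\<forall>i\<in>{1..n}. c i \<in> I [^]\<^bsub>ideals_set R\<^esub> i) \<and>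
       x [^]\<^bsub>R\<^esub> n \<oplus>\<^bsub>R\<^esub> (\<Oplus>\<^bsub>R\<^esub>i\<in>{1..n}. c i \<otimes>\<^bsub>R\<^esub> x [^]\<^bsub>R\<^esub> (n - i)) = \<zero>\<^bsub>R\<^esub>)}"

definition krull_dim :: "('a, 'r) ring_scheme \<Rightarrow> enat" where
  "krull_dim R = Sup {enat n | n. \<exists>P. (\<forall>i\<le>n. primeideal (P i) R) \<and> (\<forall>i<n. P i \<subset> P (Suc i))}"

section \<open>Filtrations and the Lojasiewicz exponent\<close>

text \<open>Only the members with index at least 1 matter.\<close>

definition filtration :: "('a, 'r) ring_scheme \<Rightarrow> (nat \<Rightarrow> 'a set) \<Rightarrow> bool" where
  "filtration R a \<longleftrightarrow>
     (\<forall>p\<ge>1. ideal (a p) R \<and> a p \<noteq> carrier R) \<and>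
     (\<forall>p\<ge>1. \<forall>p'\<ge>1. ideal_prod R (a p) (a p') \<subseteq> a (p + p')) \<and>
     (\<forall>p\<ge>1. a (p + 1) \<subseteq> a p)"

definition primary_filtration :: "('a, 'r) ring_scheme \<Rightarrow> 'a set \<Rightarrow> (nat \<Rightarrow> 'a set) \<Rightarrow> bool" where
  "primary_filtration R M a \<longleftrightarrow> filtration R a \<and> (\<forall>p\<ge>1. primary_to R M (a p))"

definition lojasiewicz :: "('a, 'r) ring_scheme \<Rightarrow> (nat \<Rightarrow> 'a set) \<Rightarrow> (nat \<Rightarrow> 'a set) \<Rightarrow> ereal" where
  "lojasiewicz R b a = Inf {ereal (real q / real p) | q p. q \<ge> 1 \<and> p \<ge> 1 \<and>
     (\<forall>\<^sub>F t in sequentially. b (q * t) \<subseteq> integral_closure R (a (p * t)))}"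

section \<open>Divisorial valuations\<close>

text \<open>Value group contained in the integers and nonzero. The valuations are not required to be
  normalised to have value group exactly the integers, so positive multiples are included.\<close>

definition discrete_valuation :: "('k, 'r) ring_scheme \<Rightarrow> ('k \<Rightarrow> ereal) \<Rightarrow> bool" where
  "discrete_valuation K v \<longleftrightarrow>
     v \<zero>\<^bsub>K\<^esub> = \<infinity> \<and>
     (\<forall>x\<in>carrier K - {\<zero>\<^bsub>K\<^esub>}. \<exists>n::int. v x = ereal (of_int n)) \<and>
     (\<exists>x\<in>carrier K - {\<zero>\<^bsub>K\<^esub>}. v x \<noteq> 0) \<and>
     (\<forall>x\<in>carrier K. \<forall>y\<in>carrier K. v (x \<otimes>\<^bsub>K\<^esub> y) = v x + v y) \<and>
     (\<forall>x\<in>carrier K. \<forall>y\<in>carrier K. v (x \<oplus>\<^bsub>K\<^esub> y) \<ge> min (v x) (v y))"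

definition valuation_ring :: "('k, 'r) ring_scheme \<Rightarrow> ('k \<Rightarrow> ereal) \<Rightarrow> ('k, 'r) ring_scheme" where
  "valuation_ring K v = K\<lparr>carrier := {x \<in> carrier K. v x \<ge> 0}\<rparr>"

definition valuation_ideal :: "('k, 'r) ring_scheme \<Rightarrow> ('k \<Rightarrow> ereal) \<Rightarrow> 'k set" where
  "valuation_ideal K v = {x \<in> carrier K. v x > 0}"

definition residue_field :: "('k, 'r) ring_scheme \<Rightarrow> ('k \<Rightarrow> ereal) \<Rightarrow> 'k set ring" where
  "residue_field K v = valuation_ring K v Quot valuation_ideal K v"

lemma field_residue_field:
  fixes K (structure)
  assumes "field K" and v: "discrete_valuation K v"
  shows "field (residue_field K v)"
proof -
  interpret field K by fact
  have v0: "v \<zero> = \<infinity>" and vZ: "\<And>x. x \<in> carrier K \<Longrightarrow> x \<noteq> \<zero> \<Longrightarrow> \<exists>n::int. v x = ereal (of_int n)"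
    and vmult: "\<And>x y. x \<in> carrier K \<Longrightarrow> y \<in> carrier K \<Longrightarrow> v (x \<otimes> y) = v x + v y"
    and vadd: "\<And>x y. x \<in> carrier K \<Longrightarrow> y \<in> carrier K \<Longrightarrow> v (x \<oplus> y) \<ge> min (v x) (v y)"
    using v by (auto simp: discrete_valuation_def)
  have v1: "v \<one> = 0"
    using vmult[of \<one> \<one>] vZ[of \<one>] by (auto simp flip: of_int_add)
  have vm1: "v (\<ominus> \<one>) = 0"
  proof -
    have "v (\<ominus> \<one>) + v (\<ominus> \<one>) = 0"
      using vmult[of "\<ominus> \<one>" "\<ominus> \<one>"] v1 by (simp add: l_minus)
    then show ?thesis using vZ[of "\<ominus> \<one>"] by (cases "v (\<ominus> \<one>)") auto
  qed
  have vneg: "v (\<ominus> x) = v x" if "x \<in> carrier K" for x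
    using vmult[of "\<ominus> \<one>" x] vm1 that by (simp add: l_minus)
  let ?O = "{x \<in> carrier K. v x \<ge> 0}"
  have sub: "subcring ?O K"
  proof (rule subcringI')
    show "subring ?O K"
    proof (rule subringI)
      fix x y assume "x \<in> ?O" "y \<in> ?O"
      then show "x \<otimes> y \<in> ?O" "x \<oplus> y \<in> ?O"
        using vmult[of x y] vadd[of x y] by (auto simp: min_def split: if_splits intro: order_trans)
    qed (auto simp: v1 vneg)
  qed
  interpret V: cring "valuation_ring K v"
    unfolding valuation_ring_def by (rule subcring_iff[THEN iffD1, OF _ sub]) auto
  have id: "ideal (valuation_ideal K v) (valuation_ring K v)"
  proof (rule idealI)
    show "ring (valuation_ring K v)" by (rule V.ring_axioms)
    show "subgroup (valuation_ideal K v) (add_monoid (valuation_ring K v))"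
    proof (rule V.add.subgroupI)
      show "valuation_ideal K v \<subseteq> carrier (valuation_ring K v)"
        by (auto simp: valuation_ideal_def valuation_ring_def)
      show "valuation_ideal K v \<noteq> {}" using v0 by (auto simp: valuation_ideal_def)
      fix x assume x: "x \<in> valuation_ideal K v"
      have xK: "x \<in> carrier K" "v x > 0" using x by (auto simp: valuation_ideal_def)
      have "\<ominus>\<^bsub>valuation_ring K v\<^esub> x = \<ominus> x"
        by (rule V.minus_equality) (use xK vneg l_neg in \<open>auto simp: valuation_ring_def\<close>)
      then show "\<ominus>\<^bsub>valuation_ring K v\<^esub> x \<in> valuation_ideal K v"
        using xK vneg by (auto simp: valuation_ideal_def)
    next
      fix x y assume "x \<in> valuation_ideal K v" "y \<in> valuation_ideal K v"
      then show "x \<oplus>\<^bsub>valuation_ring K v\<^esub> y \<in> valuation_ideal K v"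
        using vadd[of x y] by (auto simp: valuation_ideal_def valuation_ring_def min_def
            split: if_splits intro: less_le_trans)
    qed
  next
    fix x y assume "x \<in> valuation_ideal K v" "y \<in> carrier (valuation_ring K v)"
    then show "y \<otimes>\<^bsub>valuation_ring K v\<^esub> x \<in> valuation_ideal K v"
      "x \<otimes>\<^bsub>valuation_ring K v\<^esub> y \<in> valuation_ideal K v"
      using vmult[of x y] vmult[of y x]
      by (auto simp: valuation_ideal_def valuation_ring_def add_pos_nonneg add_nonneg_pos)
  qed
  have "maximalideal (valuation_ideal K v) (valuation_ring K v)"
  proof (rule maximalidealI[OF id])
    have "\<one> \<in> carrier (valuation_ring K v)" "\<one> \<notin> valuation_ideal K v"
      using v1 by (auto simp: valuation_ideal_def valuation_ring_def)
    then show "carrier (valuation_ring K v) \<noteq> valuation_ideal K v" by auto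
  next
    fix J assume J: "ideal J (valuation_ring K v)" "valuation_ideal K v \<subseteq> J"
      "J \<subseteq> carrier (valuation_ring K v)"
    show "J = valuation_ideal K v \<or> J = carrier (valuation_ring K v)"
    proof (cases "J \<subseteq> valuation_ideal K v")
      case False
      then obtain x where x: "x \<in> J" "x \<in> carrier K" "v x = 0"
        using J(3) by (force simp: valuation_ideal_def valuation_ring_def less_le)
      have xu: "x \<noteq> \<zero>" using x v0 by auto
      then have i: "inv x \<in> carrier K" "x \<otimes> inv x = \<one>" using x field_Units by auto
      then have "v (inv x) = 0" using vmult[of x "inv x"] x v1 by simp
      then have "\<one> \<in> J"
        using ideal.I_r_closed[OF J(1) x(1), of "inv x"] i by (simp add: valuation_ring_def)
      then show ?thesis using ideal.one_imp_carrier[OF J(1)] by (simp add: valuation_ring_def)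
    qed (use J in auto)
  qed
  then show ?thesis
    unfolding residue_field_def by (rule maximalideal.quotient_is_field) (rule V.cring_axioms)
qed

text \<open>The image of \<open>R\<close> in the residue field of a valuation of its fraction field; if the valuation
  is centered at the maximal ideal \<open>M\<close>, this is the residue field of \<open>R\<close>, embedded as a subfield.\<close>

definition residue_image ::
    "('a, 'r) ring_scheme \<Rightarrow> (('a \<times> 'a) set \<Rightarrow> ereal) \<Rightarrow> ('a \<times> 'a) set set set" where
  "residue_image R v =
     (\<lambda>x. valuation_ideal (frac_field R) v +>\<^bsub>valuation_ring (frac_field R) v\<^esub> fraction R x \<one>\<^bsub>R\<^esub>)
       ` carrier R"

definition transcendence_basis :: "('l, 'r) ring_scheme \<Rightarrow> 'l set \<Rightarrow> 'l set \<Rightarrow> bool" where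
  "transcendence_basis L F B \<longleftrightarrow> B \<subseteq> carrier L \<and>
     (\<forall>x\<in>B. (ring.transcendental L over generate_field L (F \<union> (B - {x}))) x) \<and>
     (\<forall>x\<in>carrier L. (ring.algebraic L over generate_field L (F \<union> B)) x)"

definition centered_at ::
    "('a, 'r) ring_scheme \<Rightarrow> 'a set \<Rightarrow> (('a \<times> 'a) set \<Rightarrow> ereal) \<Rightarrow> bool" where
  "centered_at R M v \<longleftrightarrow>
     (\<forall>x\<in>carrier R. v (fraction R x \<one>\<^bsub>R\<^esub>) \<ge> 0) \<and> (\<forall>x\<in>M. v (fraction R x \<one>\<^bsub>R\<^esub>) > 0)"

text \<open>A divisorial valuation centered at the maximal ideal: the residue field has transcendence
  degree \<open>dim R - 1\<close> over the residue field of \<open>R\<close>.\<close>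

definition divisorial_valuation ::
    "('a, 'r) ring_scheme \<Rightarrow> 'a set \<Rightarrow> (('a \<times> 'a) set \<Rightarrow> ereal) \<Rightarrow> bool" where
  "divisorial_valuation R M v \<longleftrightarrow>
     discrete_valuation (frac_field R) v \<and> centered_at R M v \<and>
     (\<exists>B. finite B \<and> transcendence_basis (residue_field (frac_field R) v) (residue_image R v) B \<and>
        enat (card B + 1) = krull_dim R)"

text \<open>The infimum is a minimum: the values on \<open>R\<close> of a valuation centered at a maximal ideal are
  natural numbers or infinite.\<close>

definition val_ideal ::
    "('a, 'r) ring_scheme \<Rightarrow> (('a \<times> 'a) set \<Rightarrow> ereal) \<Rightarrow> 'a set \<Rightarrow> ereal" where
  "val_ideal R v I = (INF x\<in>I. v (fraction R x \<one>\<^bsub>R\<^esub>))"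

definition val_filtration ::
    "('a, 'r) ring_scheme \<Rightarrow> (('a \<times> 'a) set \<Rightarrow> ereal) \<Rightarrow> (nat \<Rightarrow> 'a set) \<Rightarrow> ereal" where
  "val_filtration R v a = lim (\<lambda>p. val_ideal R v (a p) / ereal (real p))"

section \<open>Affine functions and valuation-concave paths\<close>

text \<open>An extended-real function that is affine is in particular finite on the whole interval.\<close>

definition affine_on_unit :: "(real \<Rightarrow> ereal) \<Rightarrow> bool" where
  "affine_on_unit f \<longleftrightarrow> (\<exists>c d::real. \<forall>t\<in>{0..1}. f t = ereal (c + d * t))"

definition valuation_concave ::
    "('a, 'r) ring_scheme \<Rightarrow> 'a set \<Rightarrow> (real \<Rightarrow> nat \<Rightarrow> 'a set) \<Rightarrow> (real \<Rightarrow> nat \<Rightarrow> 'a set) \<Rightarrow> bool" where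
  "valuation_concave R M a b \<longleftrightarrow> (\<forall>v. divisorial_valuation R M v \<longrightarrow>
     affine_on_unit (\<lambda>t. val_filtration R v (a t)) \<and>
     affine_on_unit (\<lambda>t. val_filtration R v (b t)))"

end

theory Submission
  imports Defs "HOL-Computational_Algebra.Polynomial"
begin

text \<open>Write \<open>g = 1 / L\<close>. Then \<open>L = \<alpha>\<^sub>i / \<beta>\<^sub>i\<close> at \<open>t\<close> exactly when \<open>t\<close> is a zero of \<open>g \<alpha>\<^sub>i - \<beta>\<^sub>i\<close>,
  a polynomial of degree at most two. The zero sets of these finitely many polynomials cover
  the infinite set \<open>[0, 1]\<close>, so one of the polynomials vanishes identically.\<close>

lemma poly_eq_0_of_cover:
  fixes p :: "'i \<Rightarrow> 'k::{comm_ring_1, ring_no_zero_divisors} poly"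
  assumes "finite I" "infinite T" and cover: "\<And>t. t \<in> T \<Longrightarrow> \<exists>i\<in>I. poly (p i) t = 0"
  shows "\<exists>i\<in>I. p i = 0"
proof (rule ccontr)
  assume "\<not> (\<exists>i\<in>I. p i = 0)"
  \<comment> \<open>Without zero divisors, a nonzero polynomial has only finitely many
    roots.\<close>
  then have "finite (\<Union>i\<in>I. {t. poly (p i) t = 0})"
    using \<open>finite I\<close> by (auto intro: poly_roots_finite)
  moreover have "T \<subseteq> (\<Union>i\<in>I. {t. poly (p i) t = 0})"
    using cover by auto
  ultimately show False
    using \<open>infinite T\<close> finite_subset by blast
qed

text \<open>This isolates the part of the argument that is free of ring theory. The values stay in
  \<open>ereal\<close> so that \<open>val_filtration\<close> and \<open>lojasiewicz\<close> can be
  substituted directly.\<close>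

lemma affine_inverse_Max_quotient:
  fixes \<alpha> \<beta> :: "'i \<Rightarrow> real \<Rightarrow> ereal" and L :: "real \<Rightarrow> ereal"
  assumes fin: "finite I" "I \<noteq> {}"
    and \<alpha>: "\<And>i. i \<in> I \<Longrightarrow> affine_on_unit (\<alpha> i)"
    and \<beta>: "\<And>i. i \<in> I \<Longrightarrow> affine_on_unit (\<beta> i)"
    and pos: "\<And>i t. i \<in> I \<Longrightarrow> t \<in> {0..1} \<Longrightarrow> \<beta> i t > 0"
    and L: "\<And>t. t \<in> {0..1} \<Longrightarrow> L t = Max ((\<lambda>i. \<alpha> i t / \<beta> i t) ` I)"
    and aff: "affine_on_unit (\<lambda>t. 1 / L t)"
  shows "\<exists>j\<in>I. \<forall>t\<in>{0..1}. L t = \<alpha> j t / \<beta> j t"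
proof -
  obtain c d where cd: "\<And>i t. i \<in> I \<Longrightarrow> t \<in> {0..1} \<Longrightarrow> \<alpha> i t = ereal (c i + d i * t)"
    using \<alpha> unfolding affine_on_unit_def by metis
  obtain c' d' where cd': "\<And>i t. i \<in> I \<Longrightarrow> t \<in> {0..1} \<Longrightarrow> \<beta> i t = ereal (c' i + d' i * t)"
    using \<beta> unfolding affine_on_unit_def by metis
  obtain e f where ef: "\<And>t. t \<in> {0..1} \<Longrightarrow> 1 / L t = ereal (e + f * t)"
    using aff unfolding affine_on_unit_def by metis
  define p where "p i = [:e, f:] * [:c i, d i:] - [:c' i, d' i:]" for i
  \<comment> \<open>Attainment serves twice: it makes \<open>L t\<close> finite, and it shows that
    the zero sets cover the interval.\<close>
  have attained: "\<exists>i\<in>I. L t = \<alpha> i t / \<beta> i t" if "t \<in> {0..1}" for t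
  proof -
    have "L t \<in> (\<lambda>i. \<alpha> i t / \<beta> i t) ` I"
      unfolding L[OF that] using fin by (intro Max_in) auto
    then show ?thesis
      by blast
  qed
  have iff: "L t = \<alpha> i t / \<beta> i t \<longleftrightarrow> poly (p i) t = 0" if i: "i \<in> I" and t: "t \<in> {0..1}" for i t
  proof -
    \<comment> \<open>Positivity of the denominator makes the extended quotient a real one.\<close>
    have quot: "\<alpha> k t / \<beta> k t = ereal ((c k + d k * t) / (c' k + d' k * t))"
      and pos': "c' k + d' k * t > 0" if "k \<in> I" for k
      using pos[OF that t] cd[OF that t] cd'[OF that t] by auto
    obtain l where l: "L t = ereal l"
      using attained[OF t] quot by auto
    \<comment> \<open>In \<open>ereal\<close>, \<open>1 / 0\<close> is \<open>\<infinity>\<close>,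
      whereas affinity forces \<open>1 / L t\<close> to be real.\<close>
    have "l \<noteq> 0"
      using ef[OF t] l by (auto simp: zero_ereal_def[symmetric] divide_ereal_def)
    then have g: "e + f * t = 1 / l"
      using ef[OF t] l by (simp add: one_ereal_def)
    have "L t = \<alpha> i t / \<beta> i t \<longleftrightarrow> l = (c i + d i * t) / (c' i + d' i * t)"
      using quot[OF i] l by simp
    also have "\<dots> \<longleftrightarrow> 1 / l * (c i + d i * t) = c' i + d' i * t"
      using pos'[OF i] \<open>l \<noteq> 0\<close> by (auto simp: divide_simps mult.commute)
    also have "\<dots> \<longleftrightarrow> poly (p i) t = 0"
      unfolding g[symmetric] p_def by (simp add: algebra_simps)
    finally show ?thesis .
  qed
  have "infinite {0..1::real}"
    by (simp add: infinite_Icc)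
  with fin(1) have "\<exists>j\<in>I. p j = 0"
  proof (rule poly_eq_0_of_cover)
    show "\<exists>i\<in>I. poly (p i) t = 0" if "t \<in> {0..1}" for t
      using attained[OF that] iff[OF _ that] by blast
  qed
  then obtain j where "j \<in> I" "p j = 0"
    by blast
  \<comment> \<open>The zero polynomial vanishes at every \<open>t\<close>, so \<open>iff\<close>
    gives the equality for this one \<open>j\<close> on the whole interval.\<close>
  then show ?thesis
    by (intro bexI[of _ j] ballI) (simp_all add: iff)
qed

theorem corollary9p16:
  fixes R :: "('a, 'r) ring_scheme" and M :: "'a set"
    and a b :: "real \<Rightarrow> nat \<Rightarrow> 'a set"
    and N :: nat and v :: "nat \<Rightarrow> ('a \<times> 'a) set \<Rightarrow> ereal"
    and \<alpha> \<beta> :: "nat \<Rightarrow> real \<Rightarrow> ereal" and L :: "real \<Rightarrow> ereal"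
  assumes "noetherian_domain R" and "local_ring R M"
    and "\<forall>t\<in>{0..1}. primary_filtration R M (a t) \<and> primary_filtration R M (b t)"
    and "N \<ge> 1" and "\<forall>i\<in>{1..N}. divisorial_valuation R M (v i)"
    and "\<alpha> = (\<lambda>i t. val_filtration R (v i) (a t))"
    and "\<beta> = (\<lambda>i t. val_filtration R (v i) (b t))"
    and "L = (\<lambda>t. lojasiewicz R (b t) (a t))"
    and "\<forall>t\<in>{0..1}. L t = Max ((\<lambda>i. \<alpha> i t / \<beta> i t) ` {1..N})"
    and "valuation_concave R M a b"
    and "\<forall>i\<in>{1..N}. \<forall>t\<in>{0..1}. \<beta> i t > 0"
    and "affine_on_unit (\<lambda>t. 1 / L t)"
  shows "(\<exists>j\<in>{1..N}. \<forall>t\<in>{0..1}. L t = \<alpha> j t / \<beta> j t) \<and>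
    (\<forall>j\<in>{1..N}. (\<forall>t\<in>{0..1}. L t = \<alpha> j t / \<beta> j t) \<longleftrightarrow>
       (\<forall>t\<in>{0..1}. j \<in> {i \<in> {1..N}. \<alpha> i t / \<beta> i t = Max ((\<lambda>k. \<alpha> k t / \<beta> k t) ` {1..N})}))"
proof -
  have "\<exists>j\<in>{1..N}. \<forall>t\<in>{0..1}. L t = \<alpha> j t / \<beta> j t"
  proof (rule affine_inverse_Max_quotient)
    \<comment> \<open>Each \<open>v i\<close> is divisorial, so valuation-concavity applies to
      it.\<close>
    show "affine_on_unit (\<alpha> i)" "affine_on_unit (\<beta> i)" if "i \<in> {1..N}" for i
      using assms(5,10) that unfolding assms(6,7) valuation_concave_def by auto
  qed (use assms(4,9,11,12) in auto)
  \<comment> \<open>The maximum in the maximizer set is \<open>L t\<close> itself, which gives the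
    equivalence.\<close>
  then show ?thesis
    using assms(9) by auto
qed

end
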